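(* Let $p$ be a prime number, let $F$ be the field with $p$ elements, and let $V$ be an $F$-vector space of finite dimension $n>0$. Suppose $\alpha,\beta\in\mathrm{GL}(V)$ are unipotent and that $\mathrm{Hol}(V,\langle\alpha\rangle)\cong\mathrm{Hol}(V,\langle\beta\rangle)$ as groups. Then $\alpha$ is similar to $\beta$, that is, there is $f\in\mathrm{GL}(V)$ with $f\alpha f^{-1}=\beta$.
   Context: For a group $G$ and a subgroup $H$ of $\mathrm{Aut}(G)$, the relative holomorph $\mathrm{Hol}(G,H)=G\rtimes H$ is the semidirect product in which $h g h^{-1}=h(g)$ for $h\in H$, $g\in G$. Here it is applied to the additive group of $V$, with $\mathrm{GL}(V)=\mathrm{Aut}(V)$. An endomorphism $\alpha$ is unipotent if $\alpha=1+\nu$ with $\nu$ a nilpotent endomorphism. *)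

theory Defs
  imports Complex_Main "HOL-Algebra.Bij" "HOL-Algebra.Generated_Groups" "HOL-Computational_Algebra.Primes"
begin

text \<open>
  The relative holomorph for a subgroup \<open>H\<close> of \<^term>\<open>AutoGroup G\<close>: the pair \<open>(g, h)\<close> stands for the
  product \<open>g h\<close>, so the rule \<open>h g' h\<inverse> = h(g')\<close> gives \<open>g h g' h' = (g h(g')) (h h')\<close>.
\<close>

definition Hol :: "('a, 'c) monoid_scheme \<Rightarrow> ('a \<Rightarrow> 'a) set \<Rightarrow> ('a \<times> ('a \<Rightarrow> 'a)) monoid" where
  "Hol G H = \<lparr>carrier = carrier G \<times> H,
     monoid.mult = (\<lambda>(g, h) (g', h'). (g \<otimes>\<^bsub>G\<^esub> h g', h \<otimes>\<^bsub>AutoGroup G\<^esub> h')),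
     one = (\<one>\<^bsub>G\<^esub>, \<one>\<^bsub>AutoGroup G\<^esub>)\<rparr>"

lemma group_Hol:
  assumes "group G" and H: "subgroup H (AutoGroup G)"
  shows "group (Hol G H)"
proof -
  interpret G: group G by fact
  interpret A: group "AutoGroup G" by (rule G.AutoGroup)
  interpret H: subgroup H "AutoGroup G" by fact
  have Haut: "h \<in> auto G" if "h \<in> H" for h
    using H.subset that by (auto simp: AutoGroup_def)
  have cl: "h x \<in> carrier G" if "h \<in> H" "x \<in> carrier G" for h x
    using Haut[OF that(1)] that(2) by (auto simp: auto_def hom_def)
  have hm: "h (x \<otimes>\<^bsub>G\<^esub> y) = h x \<otimes>\<^bsub>G\<^esub> h y" if "h \<in> H" "x \<in> carrier G" "y \<in> carrier G" for h x y
    using Haut[OF that(1)] that(2,3) by (auto simp: auto_def hom_def)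
  have mult: "(h \<otimes>\<^bsub>AutoGroup G\<^esub> k) x = h (k x)" if "h \<in> H" "k \<in> H" "x \<in> carrier G" for h k x
    using Haut[OF that(1)] Haut[OF that(2)] that(3)
    by (simp add: AutoGroup_def BijGroup_def auto_def compose_def)
  have one: "\<one>\<^bsub>AutoGroup G\<^esub> x = x" if "x \<in> carrier G" for x
    using that by (simp add: AutoGroup_def BijGroup_def)
  have Hc: "h \<in> carrier (AutoGroup G)" if "h \<in> H" for h
    using that by (rule H.mem_carrier)
  show ?thesis
  proof (rule groupI)
    fix u assume "u \<in> carrier (Hol G H)"
    then obtain g h where u: "u = (g, h)" "g \<in> carrier G" "h \<in> H"
      by (auto simp: Hol_def)
    let ?k = "inv\<^bsub>AutoGroup G\<^esub> h"
    have k: "?k \<in> H" using u by (simp add: H.m_inv_closed)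
    have "(?k (inv\<^bsub>G\<^esub> g), ?k) \<otimes>\<^bsub>Hol G H\<^esub> u = \<one>\<^bsub>Hol G H\<^esub>"
    proof -
      have "?k (inv\<^bsub>G\<^esub> g) \<otimes>\<^bsub>G\<^esub> ?k g = ?k \<one>\<^bsub>G\<^esub>"
        using u k by (simp flip: hm)
      also have "?k \<one>\<^bsub>G\<^esub> = \<one>\<^bsub>G\<^esub>"
      proof -
        have "?k \<one>\<^bsub>G\<^esub> \<otimes>\<^bsub>G\<^esub> ?k \<one>\<^bsub>G\<^esub> = ?k \<one>\<^bsub>G\<^esub>"
          using hm[OF k G.one_closed G.one_closed] by simp
        then show ?thesis using cl[OF k G.one_closed] G.l_cancel_one by blast
      qed
      finally show ?thesis using u Hc by (simp add: Hol_def)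
    qed
    moreover have "(?k (inv\<^bsub>G\<^esub> g), ?k) \<in> carrier (Hol G H)"
      using u k cl by (simp add: Hol_def)
    ultimately show "\<exists>v\<in>carrier (Hol G H). v \<otimes>\<^bsub>Hol G H\<^esub> u = \<one>\<^bsub>Hol G H\<^esub>" by blast
  next
    fix u v assume "u \<in> carrier (Hol G H)" "v \<in> carrier (Hol G H)"
    then show "u \<otimes>\<^bsub>Hol G H\<^esub> v \<in> carrier (Hol G H)"
      by (auto simp: Hol_def cl)
  next
    show "\<one>\<^bsub>Hol G H\<^esub> \<in> carrier (Hol G H)" by (simp add: Hol_def)
  next
    fix u assume "u \<in> carrier (Hol G H)"
    then show "\<one>\<^bsub>Hol G H\<^esub> \<otimes>\<^bsub>Hol G H\<^esub> u = u"
      by (auto simp: Hol_def one Hc)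
  next
    fix u v w
    assume "u \<in> carrier (Hol G H)" "v \<in> carrier (Hol G H)" "w \<in> carrier (Hol G H)"
    then show "u \<otimes>\<^bsub>Hol G H\<^esub> v \<otimes>\<^bsub>Hol G H\<^esub> w = u \<otimes>\<^bsub>Hol G H\<^esub> (v \<otimes>\<^bsub>Hol G H\<^esub> w)"
      by (auto simp: Hol_def cl hm mult G.m_assoc A.m_assoc Hc)
  qed
qed

definition additive_group :: "'b::ab_group_add monoid" where
  "additive_group = \<lparr>carrier = UNIV, monoid.mult = (+), one = 0\<rparr>"

lemma group_additive_group: "group (additive_group :: 'b::ab_group_add monoid)"
proof (rule groupI)
  fix x :: 'b
  show "\<exists>y\<in>carrier additive_group. y \<otimes>\<^bsub>additive_group\<^esub> x = \<one>\<^bsub>additive_group\<^esub>"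
    by (rule bexI[of _ "- x"]) (simp_all add: additive_group_def)
qed (simp_all add: additive_group_def add.assoc)

definition GL :: "('a::field \<Rightarrow> 'b::ab_group_add \<Rightarrow> 'b) \<Rightarrow> ('b \<Rightarrow> 'b) monoid" where
  "GL scale = \<lparr>carrier = {f. Vector_Spaces.linear scale scale f \<and> bij f}, monoid.mult = (\<circ>), one = id\<rparr>"

lemma carrier_GL_subset: "carrier (GL scale) \<subseteq> carrier (AutoGroup additive_group)"
  by (auto simp: GL_def AutoGroup_def auto_def hom_def additive_group_def Bij_def Vector_Spaces.linear_iff)

lemma mult_GL:
  assumes "f \<in> carrier (GL scale)" "g \<in> carrier (GL scale)"
  shows "f \<otimes>\<^bsub>GL scale\<^esub> g = f \<otimes>\<^bsub>AutoGroup additive_group\<^esub> g"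
  using assms
  by (auto simp: GL_def AutoGroup_def BijGroup_def additive_group_def Bij_def compose_def)

lemma one_GL: "\<one>\<^bsub>GL scale\<^esub> = \<one>\<^bsub>AutoGroup additive_group\<^esub>"
  by (auto simp: GL_def AutoGroup_def BijGroup_def additive_group_def)

lemma group_GL:
  assumes "vector_space scale"
  shows "group (GL scale)"
proof (rule groupI)
  interpret vector_space scale by fact
  interpret vector_space_pair scale scale by unfold_locales
  fix f assume f: "f \<in> carrier (GL scale)"
  then have lin: "Vector_Spaces.linear scale scale f" and bij: "bij f" by (auto simp: GL_def)
  obtain g where g: "Vector_Spaces.linear scale scale g" "g \<circ> f = id"
    using linear_injective_left_inverse[OF lin bij_is_inj[OF bij]] by blast
  have "g = inv_into UNIV f"
    using g(2) bij by (metis bij_is_surj comp_assoc comp_id id_comp surj_iff)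
  then have "bij g" using bij by (simp add: bij_imp_bij_inv)
  with g show "\<exists>g\<in>carrier (GL scale). g \<otimes>\<^bsub>GL scale\<^esub> f = \<one>\<^bsub>GL scale\<^esub>"
    by (auto simp: GL_def)
qed (use assms in \<open>auto simp: GL_def bij_comp comp_assoc Vector_Spaces.linear_iff\<close>)

lemma subgroup_GL:
  assumes "vector_space scale"
  shows "subgroup (carrier (GL scale)) (AutoGroup additive_group)"
proof -
  interpret L: group "GL scale" by (rule group_GL) fact
  interpret A: group "AutoGroup additive_group"
    by (rule group.AutoGroup[OF group_additive_group])
  show ?thesis
  proof (rule A.subgroupI[OF carrier_GL_subset])
    show "carrier (GL scale) \<noteq> {}" using L.one_closed by blast
    show "f \<otimes>\<^bsub>AutoGroup additive_group\<^esub> g \<in> carrier (GL scale)"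
      if "f \<in> carrier (GL scale)" "g \<in> carrier (GL scale)" for f g
      using L.m_closed[OF that] mult_GL[OF that] by simp
    show "inv\<^bsub>AutoGroup additive_group\<^esub> f \<in> carrier (GL scale)"
      if f: "f \<in> carrier (GL scale)" for f
    proof -
      have "inv\<^bsub>AutoGroup additive_group\<^esub> f = inv\<^bsub>GL scale\<^esub> f"
        using f L.l_inv[OF f] mult_GL[OF L.inv_closed[OF f] f] one_GL[of scale] carrier_GL_subset
        by (intro A.inv_equality) auto
      then show ?thesis using f by simp
    qed
  qed
qed

definition nilpotent_endo :: "('a::field \<Rightarrow> 'b::ab_group_add \<Rightarrow> 'b) \<Rightarrow> ('b \<Rightarrow> 'b) \<Rightarrow> bool" where
  "nilpotent_endo scale \<nu> \<longleftrightarrow> Vector_Spaces.linear scale scale \<nu> \<and> (\<exists>k. \<nu> ^^ k = (\<lambda>_. 0))"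

definition unipotent_endo :: "('a::field \<Rightarrow> 'b::ab_group_add \<Rightarrow> 'b) \<Rightarrow> ('b \<Rightarrow> 'b) \<Rightarrow> bool" where
  "unipotent_endo scale \<alpha> \<longleftrightarrow> (\<exists>\<nu>. nilpotent_endo scale \<nu> \<and> \<alpha> = (\<lambda>x. x + \<nu> x))"

end

theory Submission
  imports Defs
begin

text \<open>
  Write \<open>\<alpha> = 1 + \<nu>\<close>. Since \<open>V\<close> is abelian and normal with cyclic quotient \<open>\<langle>\<alpha>\<rangle>\<close>, the commutators of
  \<open>Hol(V, \<langle>\<alpha>\<rangle>)\<close> are exactly the elements of \<open>\<nu>(V)\<close>, and the \<open>i\<close>-fold iterated commutators are
  exactly those of \<open>\<nu>\<^sup>i(V)\<close> for \<open>i \<ge> 1\<close>. So the isomorphism type of the holomorph determines the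
  ranks of all powers of \<open>\<nu>\<close>, and these determine a nilpotent endomorphism up to similarity: a
  conjugation between the restrictions to the images of \<open>\<nu>\<close> and \<open>\<mu>\<close> extends to all of \<open>V\<close>.
\<close>

section \<open>Nilpotent endomorphisms are determined up to similarity by the ranks of their powers\<close>

context finite_dimensional_vector_space
begin

lemma rank_nullity_subspace:
  assumes lin: "Vector_Spaces.linear scale scale f" and S: "subspace S"
  shows "dim S = dim (f ` S) + dim {x \<in> S. f x = 0}"
proof -
  interpret vector_space_pair scale scale by unfold_locales
  interpret f: Vector_Spaces.linear scale scale f by fact
  let ?K = "{x \<in> S. f x = 0}"
  have K: "subspace ?K"
    using S by (auto simp: subspace_def f.add f.scale)
  obtain B where B: "B \<subseteq> ?K" "independent B" "?K \<subseteq> span B" "card B = dim ?K"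
    using basis_exists by blast
  obtain C where C: "B \<subseteq> C" "C \<subseteq> S" "independent C" "S \<subseteq> span C"
    using maximal_independent_subset_extend[of B S] B by blast
  have finC: "finite C" using C(3) by (rule finiteI_independent)
  let ?D = "C - B"
  have indD: "independent ?D" using C(3) by (rule independent_mono) auto
  \<comment> \<open>\<open>p\<close> kills \<open>B\<close> and fixes \<open>C - B\<close>, so it
    witnesses that their spans meet only in 0.\<close>
  obtain p where p: "Vector_Spaces.linear scale scale p" "\<forall>x\<in>C. p x = (if x \<in> B then 0 else x)"
    using linear_independent_extend[OF C(3), of "\<lambda>x. if x \<in> B then 0 else x"] by blast
  have p0: "p x = 0" if "x \<in> span B" for x
    by (rule linear_eq_on_span[OF p(1) linear_zero _ that]) (use p(2) C(1) in auto)
  have pid: "p x = x" if "x \<in> span ?D" for x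
    by (rule linear_eq_on_span[OF p(1) linear_ident _ that]) (use p(2) in auto)
  have inj: "inj_on f (span ?D)"
    unfolding f.inj_on_iff_eq_0[OF subspace_span]
  proof (intro ballI impI)
    fix x assume x: "x \<in> span ?D" "f x = 0"
    have "x \<in> S" using x(1) C(2) S span_minimal[of ?D S] by blast
    then have "x \<in> span B" using x(2) B(3) by blast
    then show "x = 0" using p0 pid[OF x(1)] by simp
  qed
  have "f ` S = span (f ` ?D)"
  proof
    show "f ` S \<subseteq> span (f ` ?D)"
    proof
      fix y assume "y \<in> f ` S"
      then obtain x where x: "x \<in> S" "y = f x" by blast
      have "x \<in> span (B \<union> ?D)" using C x by (metis Un_Diff_cancel sup.absorb2 subsetD)
      then obtain u v where uv: "x = u + v" "u \<in> span B" "v \<in> span ?D"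
        unfolding span_Un by blast
      have "u \<in> ?K" using uv(2) span_minimal[OF B(1) K] by blast
      then have "y = f v" using x uv by (simp add: f.add)
      then show "y \<in> span (f ` ?D)" using uv(3) by (simp add: f.span_image)
    qed
    have "span ?D \<subseteq> S" using C(2) S by (intro span_minimal) auto
    then show "span (f ` ?D) \<subseteq> f ` S" by (auto simp: f.span_image)
  qed
  then have "dim (f ` S) = card (f ` ?D)"
    using dim_span_eq_card_independent[OF f.independent_injective_image[OF indD inj]] by simp
  also have "\<dots> = card ?D"
    by (rule card_image) (meson inj inj_on_subset span_superset)
  also have "\<dots> = card C - card B"
    using C(1) finC by (simp add: card_Diff_subset finite_subset)
  finally show ?thesis
    using basis_card_eq_dim[OF C(2) C(4) C(3)] B(4) card_mono[OF finC C(1)] by simp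
qed

text \<open>The complement \<open>D\<close> consists of kernel vectors, and its size is a second difference of the
  ranks of the powers of \<open>f\<close>: it counts the Jordan blocks of size one.\<close>

lemma image_basis_extends_by_kernel:
  assumes lin: "Vector_Spaces.linear scale scale f" and S: "subspace S" and inv: "f ` S \<subseteq> S"
    and B: "independent B" "span B = f ` S"
  obtains D where "B \<inter> D = {}" "independent (B \<union> D)" "D \<subseteq> {x \<in> S. f x = 0}"
    "{x \<in> S. f x = 0} \<subseteq> span (B \<union> D)" "card D + 2 * dim (f ` S) = dim (f ` f ` S) + dim S"
proof -
  interpret f: Vector_Spaces.linear scale scale f by fact
  let ?K = "{x \<in> S. f x = 0}"
  have BS: "B \<subseteq> S" using B(2) inv span_superset by blast
  \<comment> \<open>Extending \<open>B\<close> inside \<open>B \<union> ?K\<close> forces every new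
    basis vector into the kernel.\<close>
  obtain C where C: "B \<subseteq> C" "C \<subseteq> B \<union> ?K" "independent C" "B \<union> ?K \<subseteq> span C"
    using maximal_independent_subset_extend[of B "B \<union> ?K"] B(1) by blast
  let ?D = "C - B"
  have Un: "B \<union> ?D = C" using C(1) by blast
  have D: "?D \<subseteq> ?K" using C(2) by blast
  have finC: "finite C" using C(3) by (rule finiteI_independent)
  have im: "f ` span C = f ` f ` S"
  proof
    show "f ` span C \<subseteq> f ` f ` S"
    proof
      fix y assume "y \<in> f ` span C"
      then obtain x where x: "y = f x" "x \<in> span (B \<union> ?D)" unfolding Un by blast
      obtain u v where uv: "x = u + v" "u \<in> span B" "v \<in> span ?D"
        using x(2) unfolding span_Un by blast
      have "subspace ?K" using S by (simp add: subspace_def f.add f.scale)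
      then have "v \<in> ?K" using uv(3) span_minimal[OF D] by blast
      then show "y \<in> f ` f ` S" using x(1) uv B(2) by (simp add: f.add)
    qed
    show "f ` f ` S \<subseteq> f ` span C" using span_mono[OF C(1)] B(2) by (simp add: image_mono)
  qed
  have "span C \<subseteq> S" using C(2) BS S by (intro span_minimal) auto
  \<comment> \<open>On \<open>span C\<close> and on \<open>S\<close> the map \<open>f\<close> has
    the same kernel, so subtracting the two rank formulas eliminates its dimension.\<close>
  then have "{x \<in> span C. f x = 0} = ?K" using C(4) by auto
  then have "dim (span C) + dim (f ` S) = dim (f ` f ` S) + dim S"
    using rank_nullity_subspace[OF lin S] rank_nullity_subspace[OF lin subspace_span, of C] im
    by simp
  moreover have "dim (span C) = card C" "dim (f ` S) = card B"
    using C(3) B dim_span_eq_card_independent[of C] dim_span_eq_card_independent[of B] by simp_all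
  moreover have "card C = card B + card ?D"
    using C(1) finC card_mono[OF finC C(1)] by (simp add: card_Diff_subset finite_subset)
  ultimately have "card ?D + 2 * dim (f ` S) = dim (f ` f ` S) + dim S" by linarith
  then show thesis using C(3,4) D Un by (intro that[of ?D]) auto
qed

lemma nilpotent_similar_on:
  assumes "Vector_Spaces.linear scale scale \<nu>" "Vector_Spaces.linear scale scale \<mu>"
    and "subspace S" "subspace T" "\<nu> ` S \<subseteq> S" "\<mu> ` T \<subseteq> T"
    and "\<And>x. x \<in> S \<Longrightarrow> (\<nu> ^^ k) x = 0"
    and "\<And>i. dim ((\<nu> ^^ i) ` S) = dim ((\<mu> ^^ i) ` T)"
  shows "\<exists>f. Vector_Spaces.linear scale scale f \<and> inj_on f S \<and> f ` S = T \<and> (\<forall>x\<in>S. f (\<nu> x) = \<mu> (f x))"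
  using assms
proof (induction k arbitrary: S T)
  case 0
  have S: "S = {0}" using 0(7) subspace_0[OF 0(3)] by auto
  then have "dim T = 0" using 0(8)[of 0] by simp
  then have "T = {0}" using subspace_0[OF 0(4)] by auto
  moreover have "\<nu> 0 = 0" "\<mu> 0 = 0"
    using 0(1,2) by (simp_all add: linear_iff_module_hom module_hom.zero)
  ultimately show ?case using S linear_ident by (intro exI[of _ "\<lambda>x. x"]) auto
next
  case (Suc k)
  interpret vector_space_pair scale scale by unfold_locales
  note S = \<open>subspace S\<close> and T = \<open>subspace T\<close> and inv = \<open>\<nu> ` S \<subseteq> S\<close> \<open>\<mu> ` T \<subseteq> T\<close>
  interpret nu: Vector_Spaces.linear scale scale \<nu> by fact
  interpret mu: Vector_Spaces.linear scale scale \<mu> by fact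
  have dims: "dim S = dim T" "dim (\<nu> ` S) = dim (\<mu> ` T)" "dim (\<nu> ` \<nu> ` S) = dim (\<mu> ` \<mu> ` T)"
    using Suc.prems(8)[of 0] Suc.prems(8)[of 1] Suc.prems(8)[of 2]
    by (simp_all add: numeral_2_eq_2 image_image)
  have "\<exists>f. Vector_Spaces.linear scale scale f \<and> inj_on f (\<nu> ` S) \<and> f ` \<nu> ` S = \<mu> ` T \<and>
      (\<forall>x\<in>\<nu> ` S. f (\<nu> x) = \<mu> (f x))"
  proof (rule Suc.IH)
    show "(\<nu> ^^ k) x = 0" if "x \<in> \<nu> ` S" for x
      using that Suc.prems(7) by (auto simp: funpow_swap1)
    show "dim ((\<nu> ^^ i) ` \<nu> ` S) = dim ((\<mu> ^^ i) ` \<mu> ` T)" for i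
      using Suc.prems(8)[of "Suc i"] by (simp add: image_image funpow_swap1)
    show "\<nu> ` \<nu> ` S \<subseteq> \<nu> ` S" "\<mu> ` \<mu> ` T \<subseteq> \<mu> ` T" using inv by (simp_all add: image_mono)
  qed (rule Suc.prems(1,2) nu.subspace_image[OF S] mu.subspace_image[OF T])+
  then obtain f where f: "Vector_Spaces.linear scale scale f" "inj_on f (\<nu> ` S)" "f ` \<nu> ` S = \<mu> ` T"
      "\<forall>x\<in>\<nu> ` S. f (\<nu> x) = \<mu> (f x)"
    by (elim exE conjE)
  interpret f: Vector_Spaces.linear scale scale f by fact
  have sN: "subspace (\<nu> ` S)" using S by (rule nu.subspace_image)
  obtain B where B: "B \<subseteq> \<nu> ` S" "independent B" "span B = \<nu> ` S"
    using basis_subspace_exists[OF sN] by metis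
  have fB: "independent (f ` B)" "span (f ` B) = \<mu> ` T"
    using B(2,3) f(2,3) f.independent_injective_image[of B] by (simp_all add: f.span_image)
  have injB: "inj_on f B" using f(2) B(1) by (rule inj_on_subset)
  obtain D where D: "B \<inter> D = {}" "independent (B \<union> D)" "D \<subseteq> {x \<in> S. \<nu> x = 0}"
      "{x \<in> S. \<nu> x = 0} \<subseteq> span (B \<union> D)" "card D + 2 * dim (\<nu> ` S) = dim (\<nu> ` \<nu> ` S) + dim S"
    by (rule image_basis_extends_by_kernel[OF Suc.prems(1) S inv(1) B(2,3)])
  obtain D' where D': "f ` B \<inter> D' = {}" "independent (f ` B \<union> D')" "D' \<subseteq> {x \<in> T. \<mu> x = 0}"
      "{x \<in> T. \<mu> x = 0} \<subseteq> span (f ` B \<union> D')"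
      "card D' + 2 * dim (\<mu> ` T) = dim (\<mu> ` \<mu> ` T) + dim T"
    by (rule image_basis_extends_by_kernel[OF Suc.prems(2) T inv(2) fB])
  have "finite D" "finite D'"
    using finiteI_independent[OF D(2)] finiteI_independent[OF D'(2)] by auto
  \<comment> \<open>Both sizes are the same second difference of ranks, so the kernel vectors
    outside the image can be matched by a bijection \<open>d\<close>.\<close>
  moreover have "card D = card D'" using D(5) D'(5) dims by linarith
  ultimately obtain d where d: "bij_betw d D D'"
    using finite_same_card_bij by blast
  have "B \<union> D \<subseteq> S" using B(1) D(3) inv by blast
  then obtain C where C: "B \<union> D \<subseteq> C" "C \<subseteq> S" "independent C" "S \<subseteq> span C"
    using maximal_independent_subset_extend D(2) by metis
  have "\<exists>y\<in>T. \<mu> y = f (\<nu> x)" if "x \<in> S" for x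
    using that f(3) by (metis imageI image_iff)
  then obtain t where t: "\<And>x. x \<in> S \<Longrightarrow> t x \<in> T \<and> \<mu> (t x) = f (\<nu> x)"
    by metis
  \<comment> \<open>On \<open>B\<close> the map must continue \<open>f\<close>; on \<open>D\<close>
    any bijection onto \<open>D'\<close> will do, both sides being killed; elsewhere
    \<open>t\<close> picks a preimage under \<open>\<mu>\<close> of \<open>f (\<nu> x)\<close>,
    which is exactly the intertwining condition.\<close>
  obtain g where g: "Vector_Spaces.linear scale scale g"
      "\<And>x. x \<in> C \<Longrightarrow> g x = (if x \<in> B then f x else if x \<in> D then d x else t x)"
    using linear_independent_extend[OF C(3),
        of "\<lambda>x. if x \<in> B then f x else if x \<in> D then d x else t x"] by blast
  interpret g: Vector_Spaces.linear scale scale g by fact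
  have gB: "g x = f x" if "x \<in> B" for x using that g(2) C(1) by auto
  have gD: "g x = d x" if "x \<in> D" for x
  proof -
    have "x \<in> C" "x \<notin> B" using that C(1) D(1) by auto
    then show ?thesis using that g(2) by simp
  qed
  have gN: "g x = f x" if "x \<in> \<nu> ` S" for x
    by (rule linear_eq_on_span[OF g(1) f(1) gB]) (use that B(3) in auto)
  have gT: "g x \<in> T" and gC: "g (\<nu> x) = \<mu> (g x)" if x: "x \<in> C" for x
  proof -
    have xS: "x \<in> S" using x C(2) by blast
    consider "x \<in> B" | "x \<in> D" "x \<notin> B" | "x \<notin> B" "x \<notin> D" by blast
    then have "g x \<in> T \<and> g (\<nu> x) = \<mu> (g x)"
    proof cases
      case 1
      have "f x \<in> \<mu> ` T" using 1 B(1) f(3) by blast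
      then show ?thesis using 1 gB B(1) f(4) inv gN[of "\<nu> x"] xS by auto
    next
      case 2
      have "d x \<in> D'" using d 2(1) by (auto simp: bij_betw_def)
      then have "\<nu> x = 0" "d x \<in> T" "\<mu> (d x) = 0" using 2(1) D(3) D'(3) by auto
      then show ?thesis using 2(1) gD by (simp add: g.zero)
    next
      case 3
      then show ?thesis using g(2)[OF x] t[OF xS] gN[of "\<nu> x"] xS by auto
    qed
    then show "g x \<in> T" "g (\<nu> x) = \<mu> (g x)" by auto
  qed
  have gS: "g (\<nu> x) = \<mu> (g x)" if "x \<in> S" for x
  proof -
    have "Vector_Spaces.linear scale scale (g \<circ> \<nu>)" "Vector_Spaces.linear scale scale (\<mu> \<circ> g)"
      using Suc.prems(1,2) g(1) Vector_Spaces.linear_compose by blast+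
    then have "(g \<circ> \<nu>) x = (\<mu> \<circ> g) x"
      by (rule linear_eq_on_span[of _ _ C]) (use gC that C(4) in auto)
    then show ?thesis by simp
  qed
  have "g ` (B \<union> D) = f ` B \<union> D'"
    using gB gD d by (auto simp: bij_betw_def image_Un)
  moreover have "inj_on g (B \<union> D)"
  proof -
    have "inj_on g B" "inj_on g D" "g ` B = f ` B" "g ` D = D'"
      using gB gD d injB by (auto simp: bij_betw_def inj_on_def)
    then show ?thesis using D'(1) by (auto simp: inj_on_Un)
  qed
  ultimately have injK: "inj_on g (span (B \<union> D))"
    using D'(2) g.inj_on_span_independent_image by metis
  have inj: "inj_on g S"
    unfolding g.inj_on_iff_eq_0[OF S]
  proof (intro ballI impI)
    fix x assume x: "x \<in> S" "g x = 0"
    have "f (\<nu> x) = 0" using gS[OF x(1)] x gN[of "\<nu> x"] by auto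
    then have "\<nu> x = 0" using f(2) f.inj_on_iff_eq_0[OF sN] x(1) by blast
    then have "x \<in> span (B \<union> D)" using D(4) x(1) by blast
    then show "x = 0" using injK g.inj_on_iff_eq_0[OF subspace_span] x(2) by blast
  qed
  have "g ` S \<subseteq> T"
    using gT C(4) span_minimal[OF _ T, of "g ` C"] by (auto simp: g.span_image)
  moreover have "dim (g ` S) = dim S"
  proof -
    have "{x \<in> S. g x = 0} \<subseteq> {0}" using inj g.inj_on_iff_eq_0[OF S] by auto
    then show ?thesis using rank_nullity_subspace[OF g(1) S] dim_eq_0 by simp
  qed
  ultimately have "g ` S = T"
    using dims(1) S T by (intro subspace_dim_equal g.subspace_image) auto
  then show ?case using g(1) inj gS by blast
qed

section \<open>Counting the vectors of a subspace over a finite field\<close>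

text \<open>Each new basis vector \<open>b\<close> multiplies the count by the size of the field,
  through the bijection \<open>(k, x) \<mapsto> x + k *s b\<close>. This is what turns numbers of
  commutators into ranks.\<close>

lemma card_span_independent:
  assumes "independent B" and "finite (UNIV :: 'a set)"
  shows "card (span B) = card (UNIV :: 'a set) ^ card B"
proof -
  have "finite B" using assms(1) by (rule finiteI_independent)
  then show ?thesis using assms(1)
  proof (induction B)
    case (insert b B)
    then have nb: "b \<notin> span B" and ind: "independent B"
      by (auto simp: independent_insert)
    let ?h = "\<lambda>(k, x). x + k *s b"
    have "inj_on ?h (UNIV \<times> span B)"
    proof (intro inj_onI, clarsimp)
      fix k x l y assume *: "x \<in> span B" "y \<in> span B" "x + k *s b = y + l *s b"
      then have eq: "(k - l) *s b = y - x" by (simp add: algebra_simps)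
      have "k = l"
      proof (rule ccontr)
        assume "k \<noteq> l"
        then have "b = inverse (k - l) *s (y - x)"
          using eq by (metis right_minus_eq scale_left_imp_eq scale_one scale_scale left_inverse)
        then show False using nb * by (metis span_diff span_scale)
      qed
      then show "k = l \<and> x = y" using * by simp
    qed
    moreover have "?h ` (UNIV \<times> span B) = span (insert b B)"
    proof (intro equalityI subsetI)
      fix y assume "y \<in> span (insert b B)"
      then obtain k where "y - k *s b \<in> span B" by (auto simp: span_insert)
      then show "y \<in> ?h ` (UNIV \<times> span B)" by (intro image_eqI[of _ _ "(k, y - k *s b)"]) auto
    next
      fix y assume "y \<in> ?h ` (UNIV \<times> span B)"
      then obtain k x where "x \<in> span B" "y = x + k *s b" by auto
      then have "y - k *s b \<in> span B" by simp
      then show "y \<in> span (insert b B)" unfolding span_insert by blast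
    qed
    ultimately have "card (span (insert b B)) = card ((UNIV :: 'a set) \<times> span B)"
      by (metis card_image)
    then show ?case using insert ind by (simp add: card_cartesian_product)
  qed simp
qed

lemma card_subspace:
  assumes "subspace S" and "finite (UNIV :: 'a set)"
  shows "card S = card (UNIV :: 'a set) ^ dim S"
proof -
  obtain B where "independent B" "span B = S" "card B = dim S"
    using basis_subspace_exists[OF assms(1)] by metis
  then show ?thesis using card_span_independent assms(2) by metis
qed

end

section \<open>Iterated commutators\<close>

text \<open>Writing the commutator \<open>c\<close> of \<open>x\<close> and \<open>g\<close> as the solution of \<open>x g = c g x\<close> avoids inverses.
  No subgroup is generated, so in general the members are only generators of the terms of the
  lower central series.\<close>

primrec iterated_commutators :: "('g, 'm) monoid_scheme \<Rightarrow> nat \<Rightarrow> 'g set" where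
  "iterated_commutators G 0 = carrier G"
| "iterated_commutators G (Suc i) =
    {c \<in> carrier G. \<exists>x\<in>iterated_commutators G i. \<exists>g\<in>carrier G. x \<otimes>\<^bsub>G\<^esub> g = c \<otimes>\<^bsub>G\<^esub> (g \<otimes>\<^bsub>G\<^esub> x)}"

lemma iterated_commutators_subset: "iterated_commutators G i \<subseteq> carrier G"
  by (cases i) auto

text \<open>The defining equation speaks only of products of carrier elements, so a bijective
  homomorphism preserves it and, by injectivity, reflects it.\<close>

lemma iterated_commutators_iso:
  assumes "monoid G" and \<phi>: "\<phi> \<in> iso G H"
  shows "\<phi> ` iterated_commutators G i = iterated_commutators H i"
proof (induction i)
  case 0
  show ?case using \<phi> by (auto simp: iso_def bij_betw_def)
next
  case (Suc i)
  interpret monoid G by fact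
  have hom: "\<phi> (x \<otimes>\<^bsub>G\<^esub> y) = \<phi> x \<otimes>\<^bsub>H\<^esub> \<phi> y" if "x \<in> carrier G" "y \<in> carrier G" for x y
    using \<phi> that by (auto simp: iso_def hom_def)
  have bij: "inj_on \<phi> (carrier G)" "\<phi> ` carrier G = carrier H"
    using \<phi> by (auto simp: iso_def bij_betw_def)
  have eq: "x \<otimes>\<^bsub>G\<^esub> g = c \<otimes>\<^bsub>G\<^esub> (g \<otimes>\<^bsub>G\<^esub> x) \<longleftrightarrow> \<phi> x \<otimes>\<^bsub>H\<^esub> \<phi> g = \<phi> c \<otimes>\<^bsub>H\<^esub> (\<phi> g \<otimes>\<^bsub>H\<^esub> \<phi> x)"
    if "x \<in> carrier G" "g \<in> carrier G" "c \<in> carrier G" for x g c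
    using that inj_on_eq_iff[OF bij(1)] by (simp flip: hom)
  have "iterated_commutators H (Suc i) = \<phi> ` {c \<in> carrier G. \<exists>x\<in>iterated_commutators G i.
      \<exists>g\<in>carrier G. \<phi> x \<otimes>\<^bsub>H\<^esub> \<phi> g = \<phi> c \<otimes>\<^bsub>H\<^esub> (\<phi> g \<otimes>\<^bsub>H\<^esub> \<phi> x)}"
    by (auto simp flip: Suc bij(2))
  also have "\<dots> = \<phi> ` iterated_commutators G (Suc i)"
    using eq iterated_commutators_subset[of G i]
    by (intro arg_cong[of _ _ "image \<phi>"]) (simp add: subset_iff cong: conj_cong bex_cong)
  finally show ?case by simp
qed

corollary card_iterated_commutators_iso:
  assumes "monoid G" and "G \<cong> H"
  shows "card (iterated_commutators G i) = card (iterated_commutators H i)"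
proof -
  obtain \<phi> where \<phi>: "\<phi> \<in> iso G H" using assms(2) by (auto simp: is_iso_def)
  then have "inj_on \<phi> (iterated_commutators G i)"
    by (auto simp: iso_def bij_betw_def intro: inj_on_subset[OF _ iterated_commutators_subset])
  then show ?thesis
    using iterated_commutators_iso[OF assms(1) \<phi>] card_image by metis
qed

section \<open>Iterated commutators in the holomorph of a unipotent automorphism\<close>

lemma (in group) generate_singleton_commute:
  assumes "a \<in> carrier G" "x \<in> generate G {a}" "y \<in> generate G {a}"
  shows "x \<otimes> y = y \<otimes> x"
proof -
  obtain k l :: int where "x = a [^] k" "y = a [^] l"
    using assms generate_pow by auto
  then show ?thesis
    using assms(1) int_pow_mult[of a k l] int_pow_mult[of a l k] by (simp add: add.commute)
qed

text \<open>The cyclic group is generated inside \<open>GL scale\<close>, whereas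
  \<open>group_Hol\<close> asks for a subgroup of \<open>AutoGroup additive_group\<close>; the two
  structures have the same operations on \<open>H\<close>.\<close>

lemma subgroup_GL_imp_subgroup_AutoGroup:
  assumes vs: "vector_space scale" and H: "subgroup H (GL scale)"
  shows "subgroup H (AutoGroup additive_group)"
proof -
  interpret L: group "GL scale" using vs by (rule group_GL)
  interpret A: group "AutoGroup additive_group"
    by (rule group.AutoGroup[OF group_additive_group])
  interpret H: subgroup H "GL scale" by fact
  have sub: "H \<subseteq> carrier (AutoGroup additive_group)"
    using H.subset carrier_GL_subset by blast
  have mult: "f \<otimes>\<^bsub>AutoGroup additive_group\<^esub> g = f \<otimes>\<^bsub>GL scale\<^esub> g" if "f \<in> H" "g \<in> H" for f g
    using that mult_GL[of f scale g] H.subset by auto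
  show ?thesis
  proof (rule A.subgroupI[OF sub])
    show "H \<noteq> {}" using H.one_closed by blast
    fix f g assume f: "f \<in> H"
    show "f \<otimes>\<^bsub>AutoGroup additive_group\<^esub> g \<in> H" if "g \<in> H"
      using f that by (simp add: mult)
    have "inv\<^bsub>AutoGroup additive_group\<^esub> f = inv\<^bsub>GL scale\<^esub> f"
      using f sub one_GL[of scale] by (intro A.inv_equality) (auto simp: mult)
    then show "inv\<^bsub>AutoGroup additive_group\<^esub> f \<in> H" using f by simp
  qed
qed

text \<open>Powers of \<open>\<alpha>\<close> with any integer exponent have the form
  \<open>1 + \<nu> q\<close> with \<open>q\<close> commuting with \<open>\<nu>\<close>. Hence
  \<open>k - 1\<close> maps the image of each power of \<open>\<nu>\<close> into the image of the
  next, which bounds commutators from above. Linearity of \<open>q\<close> is not recorded.\<close>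

lemma generate_GL_unipotent:
  assumes vs: "vector_space scale" and \<alpha>: "\<alpha> \<in> carrier (GL scale)"
    and \<nu>: "Vector_Spaces.linear scale scale \<nu>" "\<alpha> = (\<lambda>x. x + \<nu> x)"
    and k: "k \<in> generate (GL scale) {\<alpha>}"
  shows "\<exists>q. (\<forall>x. q (\<nu> x) = \<nu> (q x)) \<and> (\<forall>x. k x = x + \<nu> (q x))"
  using k
proof (induction k)
  interpret group "GL scale" using vs by (rule group_GL)
  interpret nu: Vector_Spaces.linear scale scale \<nu> by fact
  case one
  show ?case by (intro exI[of _ "\<lambda>_. 0"]) (simp add: GL_def)
  case (incl h)
  then show ?case using \<nu>(2) by (intro exI[of _ "\<lambda>x. x"]) auto
  case (inv h)
  \<comment> \<open>From \<open>(1 + \<nu>) ?a = 1\<close> comes \<open>?a = 1 - \<nu> ?a\<close>,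
    so \<open>q = - ?a\<close>. Comparing with \<open>?a (1 + \<nu>) = 1\<close> shows that
    \<open>?a\<close> commutes with \<open>\<nu>\<close>.\<close>
  let ?a = "inv\<^bsub>GL scale\<^esub> \<alpha>"
  have "?a \<in> carrier (GL scale)" using \<alpha> by simp
  then interpret a: Vector_Spaces.linear scale scale ?a by (simp add: GL_def)
  have \<alpha>_app: "\<alpha> x = x + \<nu> x" for x by (simp add: \<nu>(2))
  have right: "?a x + \<nu> (?a x) = x" for x
    using fun_cong[OF r_inv[OF \<alpha>], of x] \<alpha>_app[of "?a x"] by (simp add: GL_def)
  have left: "?a x + ?a (\<nu> x) = x" for x
    using fun_cong[OF l_inv[OF \<alpha>], of x] \<alpha>_app[of x] a.add[of x "\<nu> x"] by (simp add: GL_def)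
  have "?a (\<nu> x) = \<nu> (?a x)" for x
    by (rule add_left_imp_eq[of "?a x"]) (simp only: left right)
  moreover have "?a x = x - \<nu> (?a x)" for x
    using right[of x] by (simp only: eq_diff_eq)
  ultimately show ?case using inv by (intro exI[of _ "\<lambda>x. - ?a x"]) (simp add: nu.neg)
next
  interpret nu: Vector_Spaces.linear scale scale \<nu> by fact
  case (eng h1 h2)
  then obtain q1 q2 where q: "\<And>x. q1 (\<nu> x) = \<nu> (q1 x)" "\<And>x. h1 x = x + \<nu> (q1 x)"
      "\<And>x. q2 (\<nu> x) = \<nu> (q2 x)" "\<And>x. h2 x = x + \<nu> (q2 x)"
    by blast
  \<comment> \<open>Read off from \<open>(1 + \<nu> q1) (1 + \<nu> q2) = 1 + \<nu> (q2 + q1 (1 +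
    \<nu> q2))\<close>; the last bracket stays unexpanded, as \<open>q1\<close> need not be
    additive.\<close>
  define q where "q x = q2 x + q1 (x + \<nu> (q2 x))" for x
  have "q (\<nu> x) = \<nu> (q x)" for x
  proof -
    have "q (\<nu> x) = q2 (\<nu> x) + q1 (\<nu> (x + \<nu> (q2 x)))" by (simp add: q_def q(3) nu.add)
    also have "\<dots> = \<nu> (q x)" unfolding q(1,3) by (simp add: q_def nu.add)
    finally show ?thesis .
  qed
  moreover have "(h1 \<otimes>\<^bsub>GL scale\<^esub> h2) x = x + \<nu> (q x)" for x
    by (simp add: GL_def q_def q nu.add add.assoc)
  ultimately show ?case by blast
qed

text \<open>Commutators satisfy \<open>u = (h - 1) w - (k - 1) v\<close>, which lies in the image of
  \<open>\<nu>\<close>; from the second stage on \<open>h = id\<close>, so each stage applies one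
  more \<open>\<nu>\<close>. Commutators with \<open>\<alpha>\<close> alone already fill the image.
  The index starts at \<open>Suc i\<close> because stage 0 is the whole group.\<close>

lemma iterated_commutators_Hol:
  fixes scale :: "'a::field \<Rightarrow> 'b::ab_group_add \<Rightarrow> 'b"
  assumes vs: "vector_space scale" and \<alpha>: "\<alpha> \<in> carrier (GL scale)"
    and \<nu>: "Vector_Spaces.linear scale scale \<nu>" "\<alpha> = (\<lambda>x. x + \<nu> x)"
  shows "iterated_commutators (Hol additive_group (generate (GL scale) {\<alpha>})) (Suc i)
    = (\<nu> ^^ Suc i) ` UNIV \<times> {id}"
proof -
  interpret group "GL scale" using vs by (rule group_GL)
  interpret nu: Vector_Spaces.linear scale scale \<nu> by fact
  let ?A = "generate (GL scale) {\<alpha>}"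
  let ?G = "Hol additive_group ?A"
  have AGL: "?A \<subseteq> carrier (GL scale)" using \<alpha> generate_incl by blast
  have carrier: "carrier ?G = UNIV \<times> ?A" by (simp add: Hol_def additive_group_def)
  have clA: "h \<circ> k \<in> ?A" if "h \<in> ?A" "k \<in> ?A" for h k
    using generate.eng[OF that] by (simp add: GL_def)
  have idA: "id \<in> ?A" using generate.one[of "GL scale"] by (simp add: GL_def)
  have \<alpha>A: "\<alpha> \<in> ?A" by (simp add: generate.incl)
  have mult: "(v, h) \<otimes>\<^bsub>?G\<^esub> (w, k) = (v + h w, h \<circ> k)" if "h \<in> ?A" "k \<in> ?A" for v h w k
  proof -
    have "h \<otimes>\<^bsub>AutoGroup additive_group\<^esub> k = h \<circ> k"
      using mult_GL[OF subsetD[OF AGL that(1)] subsetD[OF AGL that(2)]] by (simp add: GL_def)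
    then show ?thesis by (simp add: Hol_def) (simp add: additive_group_def)
  qed
  have comm: "h \<circ> k = k \<circ> h" if "h \<in> ?A" "k \<in> ?A" for h k
    using generate_singleton_commute[OF \<alpha> that] by (simp add: GL_def)
  have l_id: "l = id" if "h \<in> ?A" "k \<in> ?A" "h \<circ> k = l \<circ> (k \<circ> h)" for h k l
  proof -
    have "bij (h \<circ> k)" using clA[OF that(1,2)] AGL by (auto simp: GL_def)
    moreover have "l \<circ> (h \<circ> k) = id \<circ> (h \<circ> k)" using that comm by simp
    ultimately show ?thesis by (metis bij_is_surj comp_assoc comp_id surj_iff)
  qed
  \<comment> \<open>As the acting group is abelian, a commutator has trivial second component; only
    the first components of the defining equation remain.\<close>
  have key: "iterated_commutators ?G (Suc i) = {(u, l). l = id \<and>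
      (\<exists>(v, h)\<in>iterated_commutators ?G i. \<exists>w. \<exists>k\<in>?A. v + h w = u + w + k v)}" for i
  proof (intro equalityI subsetI)
    fix c :: "'b \<times> ('b \<Rightarrow> 'b)" assume "c \<in> iterated_commutators ?G (Suc i)"
    then obtain u l v h w k where c: "c = (u, l)" "l \<in> ?A" "(v, h) \<in> iterated_commutators ?G i"
        "k \<in> ?A" "(v, h) \<otimes>\<^bsub>?G\<^esub> (w, k) = (u, l) \<otimes>\<^bsub>?G\<^esub> ((w, k) \<otimes>\<^bsub>?G\<^esub> (v, h))"
      by (auto simp: carrier)
    have h: "h \<in> ?A" using c(3) iterated_commutators_subset[of ?G i] by (auto simp: carrier)
    have "l = id" using c h clA l_id[of h k l] by (simp add: mult)
    moreover have "v + h w = u + w + k v"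
      using c(5) c(2,4) h clA \<open>l = id\<close> by (simp add: mult add.assoc)
    ultimately show "c \<in> {(u, l). l = id \<and>
      (\<exists>(v, h)\<in>iterated_commutators ?G i. \<exists>w. \<exists>k\<in>?A. v + h w = u + w + k v)}" using c by blast
  next
    fix c :: "'b \<times> ('b \<Rightarrow> 'b)" assume "c \<in> {(u, l). l = id \<and>
      (\<exists>(v, h)\<in>iterated_commutators ?G i. \<exists>w. \<exists>k\<in>?A. v + h w = u + w + k v)}"
    then obtain u v h w k where c: "c = (u, id)" "(v, h) \<in> iterated_commutators ?G i" "k \<in> ?A"
        "v + h w = u + w + k v" by blast
    have h: "h \<in> ?A" using c(2) iterated_commutators_subset[of ?G i] by (auto simp: carrier)
    have "(v, h) \<otimes>\<^bsub>?G\<^esub> (w, k) = c \<otimes>\<^bsub>?G\<^esub> ((w, k) \<otimes>\<^bsub>?G\<^esub> (v, h))"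
      using c h comm idA clA by (simp add: mult add.assoc)
    then show "c \<in> iterated_commutators ?G (Suc i)"
      using c idA by (auto simp: carrier)
  qed
  note unip = generate_GL_unipotent[OF vs \<alpha> \<nu>]
  show ?thesis
  proof (induction i)
    case 0
    have "u \<in> \<nu> ` UNIV" if h: "h \<in> ?A" and k: "k \<in> ?A" and eq: "v + h w = u + w + k v" for u v h w k
    proof -
      obtain q r where "\<And>x. h x = x + \<nu> (q x)" "\<And>x. k x = x + \<nu> (r x)"
        using unip[OF h] unip[OF k] by blast
      then have "u = \<nu> (q w - r v)" using eq by (simp add: nu.diff algebra_simps)
      then show ?thesis by blast
    qed
    \<comment> \<open>The commutator of the translation by \<open>- y\<close> with
      \<open>\<alpha>\<close> is the translation by
      \<open>- y - \<alpha> (- y) = \<nu> y\<close>.\<close>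
    moreover have "\<exists>v. \<exists>h\<in>?A. \<exists>w. \<exists>k\<in>?A. v + h w = \<nu> y + w + k v" for y
      using idA \<alpha>A by (intro exI[of _ "- y"] bexI[of _ id] exI[of _ 0] bexI[of _ \<alpha>])
        (auto simp: \<nu>(2) nu.neg)
    ultimately show ?case unfolding key by (fastforce simp: carrier)
  next
    case (Suc i)
    have pow: "q ((\<nu> ^^ j) x) = (\<nu> ^^ j) (q x)" if "\<And>x. q (\<nu> x) = \<nu> (q x)" for q j x
      by (induction j) (simp_all add: that)
    have lin_pow: "(\<nu> ^^ j) (- x) = - (\<nu> ^^ j) x" for j x
      by (induction j) (simp_all add: nu.neg)
    have "u \<in> (\<nu> ^^ Suc (Suc i)) ` UNIV"
      if k: "k \<in> ?A" and eq: "v + w = u + w + k v" and v: "v = (\<nu> ^^ Suc i) y" for u v w k y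
    proof -
      obtain r where r: "\<And>x. r (\<nu> x) = \<nu> (r x)" "\<And>x. k x = x + \<nu> (r x)"
        using unip[OF k] by blast
      \<comment> \<open>With \<open>h = id\<close> the vector \<open>w\<close> cancels and leaves
        \<open>u = v - k v\<close>; moving \<open>r\<close> past the powers of \<open>\<nu>\<close>
        exhibits one more factor \<open>\<nu>\<close>.\<close>
      have "u = - \<nu> (r v)" using eq r by (simp add: algebra_simps eq_neg_iff_add_eq_0)
      also have "\<dots> = (\<nu> ^^ Suc (Suc i)) (- r y)"
        unfolding lin_pow v using pow[of r "Suc i", OF r(1)] by simp
      finally show ?thesis by blast
    qed
    moreover have "\<exists>v\<in>(\<nu> ^^ Suc i) ` UNIV. \<exists>w. \<exists>k\<in>?A. v + w = (\<nu> ^^ Suc (Suc i)) y + w + k v" for y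
    proof -
      have "(\<nu> ^^ Suc i) (- y) + 0 = (\<nu> ^^ Suc (Suc i)) y + 0 + \<alpha> ((\<nu> ^^ Suc i) (- y))"
        by (simp add: \<nu>(2) lin_pow nu.neg)
      then show ?thesis using \<alpha>A by blast
    qed
    ultimately show ?case unfolding key[of "Suc i"] Suc by fastforce
  qed
qed

section \<open>From isomorphic holomorphs to similar automorphisms\<close>

theorem theorem5p2:
  fixes p n :: nat
    and scale :: "'a::field \<Rightarrow> 'b::ab_group_add \<Rightarrow> 'b"
    and Basis :: "'b set"
    and \<alpha> \<beta> :: "'b \<Rightarrow> 'b"
  assumes "prime p"
    and "card (UNIV :: 'a set) = p"
    and "finite_dimensional_vector_space scale Basis"
    and "vector_space.dim scale (UNIV :: 'b set) = n"
    and "n > 0"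
    and "\<alpha> \<in> carrier (GL scale)" and "\<beta> \<in> carrier (GL scale)"
    and "unipotent_endo scale \<alpha>" and "unipotent_endo scale \<beta>"
    and "Hol additive_group (generate (GL scale) {\<alpha>}) \<cong> Hol additive_group (generate (GL scale) {\<beta>})"
  shows "\<exists>f \<in> carrier (GL scale). f \<otimes>\<^bsub>GL scale\<^esub> \<alpha> \<otimes>\<^bsub>GL scale\<^esub> inv\<^bsub>GL scale\<^esub> f = \<beta>"
proof -
  interpret finite_dimensional_vector_space scale Basis by fact
  have vs: "vector_space scale" by unfold_locales
  interpret group "GL scale" using vs by (rule group_GL)
  note \<alpha> = assms(6) and \<beta> = assms(7)
  have fin: "finite (UNIV :: 'a set)" and card: "card (UNIV :: 'a set) > 1"
    using assms(1,2) prime_gt_1_nat[of p] card_ge_0_finite[of "UNIV :: 'a set"] by auto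
  obtain \<nu> k where \<nu>: "Vector_Spaces.linear scale scale \<nu>" "\<alpha> = (\<lambda>x. x + \<nu> x)" "\<nu> ^^ k = (\<lambda>_. 0)"
    using assms(8) by (auto simp: unipotent_endo_def nilpotent_endo_def)
  obtain \<mu> where \<mu>: "Vector_Spaces.linear scale scale \<mu>" "\<beta> = (\<lambda>x. x + \<mu> x)"
    using assms(9) by (auto simp: unipotent_endo_def nilpotent_endo_def)
  have sub: "subspace ((\<gamma> ^^ i) ` UNIV)" if "Vector_Spaces.linear scale scale \<gamma>" for \<gamma> i
  proof -
    interpret Vector_Spaces.linear scale scale \<gamma> by fact
    show ?thesis
    proof (induction i)
      case (Suc i)
      then show ?case using subspace_image[of "(\<gamma> ^^ i) ` UNIV"] by (simp add: image_image)
    qed simp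
  qed
  have mon: "monoid (Hol additive_group (generate (GL scale) {\<alpha>}))"
    using group_Hol[OF group_additive_group subgroup_GL_imp_subgroup_AutoGroup[OF vs]]
      generate_is_subgroup[of "{\<alpha>}"] \<alpha> group.is_monoid by blast
  \<comment> \<open>For \<open>i = 0\<close> both sides are the dimension of the whole space. For
    positive \<open>i\<close> the commutator sets have equal size, and the exponents can be compared
    because the field has more than one element.\<close>
  have dims: "dim ((\<nu> ^^ i) ` UNIV) = dim ((\<mu> ^^ i) ` UNIV)" for i
  proof (cases i)
    case (Suc j)
    have "card ((\<nu> ^^ i) ` UNIV \<times> {id :: 'b \<Rightarrow> 'b}) = card ((\<mu> ^^ i) ` UNIV \<times> {id :: 'b \<Rightarrow> 'b})"
      using card_iterated_commutators_iso[OF mon assms(10), of i] Suc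
        iterated_commutators_Hol[OF vs \<alpha> \<nu>(1,2)] iterated_commutators_Hol[OF vs \<beta> \<mu>] by metis
    then show ?thesis
      using card_subspace[OF sub fin] \<nu>(1) \<mu>(1) card by (simp add: card_cartesian_product)
  qed simp
  obtain f where f: "Vector_Spaces.linear scale scale f" "inj f" "surj f" "\<And>x. f (\<nu> x) = \<mu> (f x)"
    using nilpotent_similar_on[OF \<nu>(1) \<mu>(1), of UNIV UNIV k] dims \<nu>(3) by auto
  then have fGL: "f \<in> carrier (GL scale)" by (simp add: GL_def bij_def)
  interpret f: Vector_Spaces.linear scale scale f by fact
  \<comment> \<open>Adding \<open>f\<close> to both sides of \<open>f \<nu> = \<mu> f\<close> turns
    it into \<open>f \<alpha> = \<beta> f\<close>.\<close>
  have "f \<otimes>\<^bsub>GL scale\<^esub> \<alpha> = \<beta> \<otimes>\<^bsub>GL scale\<^esub> f"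
    using f(4) by (auto simp: GL_def \<nu>(2) \<mu>(2) f.add)
  then have "f \<otimes>\<^bsub>GL scale\<^esub> \<alpha> \<otimes>\<^bsub>GL scale\<^esub> inv\<^bsub>GL scale\<^esub> f = \<beta>"
    using fGL \<alpha> \<beta> by (simp add: m_assoc)
  then show ?thesis using fGL by blast
qed

end
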